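(* Let $\pi\in\mathcal S_n(321)$. Then $\Psi_{BJS}(\pi)=\Psi_K(\Phi(\pi))$.
   Context: $\mathcal S_n$ is the symmetric group on $\{1,\dots,n\}$, with permutations written as words. $\mathcal S_n(\tau)$ is the set of permutations in $\mathcal S_n$ avoiding the pattern $\tau$ (no subsequence in the same relative order as $\tau$). An excedance of $\pi$ is an $i\in\{1,\dots,n-1\}$ with $\pi_i>i$. A Dyck path of length $2n$ is a lattice path from $(0,0)$ to $(2n,0)$ with up-steps $[1,1]$ and down-steps $[1,-1]$ never falling below the $x$-axis. Diagram and $\Phi$: the diagram of $\sigma\in\mathcal S_n$ is $D(\sigma)=\{(i,j): j<\sigma_i,\ \sigma^{-1}(j)>i\}$. Let $\mathcal Y_n$ be the set of partitions $(\lambda_1,\dots,\lambda_{n-1})$, $\lambda_1\ge\dots\ge\lambda_{n-1}\ge0$, with $\lambda_i\le n-i$ for all $i$, identified with their Young diagrams $\{(i,j):1\le j\le\lambda_i\}$. The map $\sigma\mapsto D(\sigma)$ is a bijection $\mathcal S_n(132)\to\mathcal Y_n$. A corner of a Young diagram is a square $(i,j)$ of it such that neither $(i+1,j)$ nor $(i,j+1)$ belongs to it. For $\pi\in\mathcal S_n(321)$ with excedances $i_1<\dots<i_e$, $\Phi(\pi)$ is the unique permutation in $\mathcal S_n(132)$ whose diagram is the Young diagram with corners exactly $(i_k,n+1-\pi_{i_k})$, $k=1,\dots,e$. $\Psi_{BJS}$ (Billey–Jockusch–Stanley bijection from $\mathcal S_n(321)$ to Dyck paths of length $2n$): for $\pi\in\mathcal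 S_n(321)$ with excedances $i_1<\dots<i_e$, put $a_k:=\pi_{i_k}-1$ and $b_k:=i_k$ for $k=1,\dots,e$, $a_0=b_0:=0$, $a_{e+1}=b_{e+1}:=n$. The path starts at the origin and is generated by adjoining, successively for $k=1,\dots,e+1$, $a_k-a_{k-1}$ up-steps followed by $b_k-b_{k-1}$ down-steps. $\Psi_K$ (Krattenthaler's bijection from $\mathcal S_n(132)$ to Dyck paths of length $2n$): for $\sigma\in\mathcal S_n(132)$ let $c_1>\dots>c_m$ be the left-to-right minima of $\sigma$ (elements $\sigma_i$ with $\sigma_i<\sigma_j$ for all $j<i$), in order of appearance, and $c_0:=n+1$. Let $d_k$ be one plus the number of letters of $\sigma$ strictly between $c_k$ and $c_{k+1}$ (for $k=m$: one plus the number of letters after $c_m$). The path starts at the origin and is generated by adjoining, successively for $k=1,\dots,m$, $c_{k-1}-c_k$ up-steps followed by $d_k$ down-steps. *)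

theory Defs
  imports Main "HOL-Combinatorics.Permutations"
begin

text \<open>Permutations in S_n are functions on nat that permute {1..n}; the word of p is
  p 1, ..., p n. All positions, letters and squares are 1-based.\<close>

definition contains_pattern :: "nat \<Rightarrow> (nat \<Rightarrow> nat) \<Rightarrow> nat list \<Rightarrow> bool" where
  "contains_pattern n p \<tau> \<longleftrightarrow>
    (\<exists>f. strict_mono_on {..<length \<tau>} f \<and> f ` {..<length \<tau>} \<subseteq> {1..n} \<and>
      (\<forall>a<length \<tau>. \<forall>b<length \<tau>. p (f a) < p (f b) \<longleftrightarrow> \<tau> ! a < \<tau> ! b))"

definition avoiding_perms :: "nat \<Rightarrow> nat list \<Rightarrow> (nat \<Rightarrow> nat) set" where
  "avoiding_perms n \<tau> = {p. p permutes {1..n} \<and> \<not> contains_pattern n p \<tau>}"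

definition excedances :: "nat \<Rightarrow> (nat \<Rightarrow> nat) \<Rightarrow> nat set" where
  "excedances n p = {i \<in> {1..n - 1}. p i > i}"

definition diagram :: "nat \<Rightarrow> (nat \<Rightarrow> nat) \<Rightarrow> (nat \<times> nat) set" where
  "diagram n \<sigma> = {(i, j). i \<in> {1..n} \<and> j \<in> {1..n} \<and> j < \<sigma> i \<and> inv \<sigma> j > i}"

text \<open>A partition (l_1, ..., l_(n-1)) is a function of which only the values on {1..n-1}
  are relevant; the set of Young diagrams does not depend on the other values.\<close>

definition young_diagram :: "nat \<Rightarrow> (nat \<Rightarrow> nat) \<Rightarrow> (nat \<times> nat) set" where
  "young_diagram n l = {(i, j). i \<in> {1..n - 1} \<and> 1 \<le> j \<and> j \<le> l i}"

definition staircase_diagrams :: "nat \<Rightarrow> (nat \<times> nat) set set" where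
  "staircase_diagrams n =
    {young_diagram n l | l. antimono_on {1..n - 1} l \<and> (\<forall>i\<in>{1..n - 1}. l i \<le> n - i)}"

definition corners :: "(nat \<times> nat) set \<Rightarrow> (nat \<times> nat) set" where
  "corners Y = {(i, j). (i, j) \<in> Y \<and> (i + 1, j) \<notin> Y \<and> (i, j + 1) \<notin> Y}"

definition Phi :: "nat \<Rightarrow> (nat \<Rightarrow> nat) \<Rightarrow> (nat \<Rightarrow> nat)" where
  "Phi n p = (THE \<sigma>. \<sigma> \<in> avoiding_perms n [1, 3, 2] \<and> diagram n \<sigma> \<in> staircase_diagrams n \<and>
     corners (diagram n \<sigma>) = (\<lambda>i. (i, n + 1 - p i)) ` excedances n p)"

text \<open>Lattice paths from the origin are given by their step sequences:
  Up is the step [1,1] and Down is the step [1,-1].\<close>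

datatype step = Up | Down

text \<open>For p avoiding 321 the sequences a and b below are weakly increasing, so the
  truncated subtractions are exact.\<close>

definition Psi_BJS :: "nat \<Rightarrow> (nat \<Rightarrow> nat) \<Rightarrow> step list" where
  "Psi_BJS n p =
    (let is = sorted_list_of_set (excedances n p);
         e = length is;
         a = (\<lambda>k. if k = 0 then 0 else if k \<le> e then p (is ! (k - 1)) - 1 else n);
         b = (\<lambda>k. if k = 0 then 0 else if k \<le> e then is ! (k - 1) else n)
     in concat (map (\<lambda>k. replicate (a k - a (k - 1)) Up @ replicate (b k - b (k - 1)) Down)
          [1..<e + 2]))"

definition lr_min_positions :: "nat \<Rightarrow> (nat \<Rightarrow> nat) \<Rightarrow> nat set" where
  "lr_min_positions n \<sigma> = {i \<in> {1..n}. \<forall>j\<in>{1..<i}. \<sigma> i < \<sigma> j}"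

definition Psi_K :: "nat \<Rightarrow> (nat \<Rightarrow> nat) \<Rightarrow> step list" where
  "Psi_K n \<sigma> =
    (let ps = sorted_list_of_set (lr_min_positions n \<sigma>);
         m = length ps;
         c = (\<lambda>k. if k = 0 then n + 1 else \<sigma> (ps ! (k - 1)));
         d = (\<lambda>k. 1 + card {i \<in> {1..n}. ps ! (k - 1) < i \<and> (k < m \<longrightarrow> i < ps ! k)})
     in concat (map (\<lambda>k. replicate (c (k - 1) - c k) Up @ replicate (d k) Down) [1..<m + 1]))"

end

theory Submission imports Defs begin

text \<open>
  Both paths are read off from the same Young diagram. Let \<open>i\<^sub>1 < \<dots> < i\<^sub>e\<close> be the excedances of
  \<open>\<pi>\<close>. Since \<open>\<pi>\<close> avoids 321, the letters at the excedances increase, so the squares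
  \<open>(i\<^sub>k, n + 1 - \<pi> i\<^sub>k)\<close> go strictly down and to the left and are the corners of a unique Young
  diagram; it fits under the staircase because \<open>\<pi> i\<^sub>k > i\<^sub>k\<close>. Its row lengths \<open>l\<close> are constant on
  each block \<open>i\<^sub>k < i \<le> i\<^sub>k\<^sub>+\<^sub>1\<close> (where \<open>i\<^sub>0 = 0\<close>), with value \<open>n + 1 - \<pi> i\<^sub>k\<^sub>+\<^sub>1\<close>, and zero after \<open>i\<^sub>e\<close>.

  That \<open>\<sigma> = \<Phi>(\<pi>)\<close> is well defined rests on three facts: a permutation is determined by its
  diagram (\<open>diagram_inject\<close>), a Young diagram is determined by its corners
  (\<open>staircase_diagram_determined_by_corners\<close>), and every staircase partition \<open>l\<close> comes from a
  132-avoiding permutation, obtained by letting each \<open>\<sigma> i\<close> be the least unused letter above \<open>l i\<close>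
  (\<open>staircase_permutation_exists\<close>).

  The key step is \<open>left_to_right_minima_of_young_diagram\<close>: when the diagram of \<open>\<sigma>\<close> has row lengths
  \<open>l\<close>, a new left-to-right minimum appears exactly at position 1 and right after each row
  containing a corner, and the letter at such a position \<open>i\<close> is
  \<open>l i + 1\<close>. So the minima of \<open>\<Phi>(\<pi>)\<close> stand at
  \<open>1, i\<^sub>1 + 1, \<dots>, i\<^sub>e + 1\<close> and are \<open>c\<^sub>k = n + 1 - a\<^sub>k\<close>, where \<open>a\<^sub>k = \<pi> i\<^sub>k - 1\<close> for \<open>k \<le> e\<close>
  and the last one is 1. Differences of consecutive minima are then the numbers of up-steps of the
  Billey-Jockusch-Stanley path, and distances between their positions are its numbers of
  down-steps.
\<close>

section \<open>Patterns of length three\<close>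

lemma contains_pattern_3_iff:
  "contains_pattern n p [a, b, c] \<longleftrightarrow>
    (\<exists>x y z. 1 \<le> x \<and> x < y \<and> y < z \<and> z \<le> n \<and>
      (p x < p y \<longleftrightarrow> a < b) \<and> (p x < p z \<longleftrightarrow> a < c) \<and> (p y < p z \<longleftrightarrow> b < c) \<and>
      (p y < p x \<longleftrightarrow> b < a) \<and> (p z < p x \<longleftrightarrow> c < a) \<and> (p z < p y \<longleftrightarrow> c < b))"
  (is "?L \<longleftrightarrow> ?R")
proof
  have three: "{..<length [a, b, c]} = {0, 1, 2}" by auto
  {
    assume ?L
    then obtain f where f: "strict_mono_on {0, 1, 2} f" "f ` {0, 1, 2} \<subseteq> {1..n}"
      and ord: "\<And>u v. u < 3 \<Longrightarrow> v < 3 \<Longrightarrow> p (f u) < p (f v) \<longleftrightarrow> [a, b, c] ! u < [a, b, c] ! v"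
      unfolding contains_pattern_def three by (auto simp: numeral_3_eq_3)
    have "f 0 < f 1" "f 1 < f 2" using f(1) by (auto simp: strict_mono_on_def)
    moreover have "1 \<le> f 0" "f 2 \<le> n" using f(2) by auto
    moreover note ord[of 0 1] ord[of 0 2] ord[of 1 2] ord[of 1 0] ord[of 2 0] ord[of 2 1]
    ultimately show ?R
      by (intro exI[of _ "f 0"] exI[of _ "f 1"] exI[of _ "f 2"]) simp
  next
    assume ?R
    then obtain x y z where xyz: "1 \<le> x" "x < y" "y < z" "z \<le> n"
      and ord: "p x < p y \<longleftrightarrow> a < b" "p x < p z \<longleftrightarrow> a < c" "p y < p z \<longleftrightarrow> b < c"
        "p y < p x \<longleftrightarrow> b < a" "p z < p x \<longleftrightarrow> c < a" "p z < p y \<longleftrightarrow> c < b"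
      by (elim exE conjE) (rule that)
    define f where "f = (!) [x, y, z]"
    have "strict_mono_on {0, 1, 2} f" "f ` {0, 1, 2} \<subseteq> {1..n}"
      using xyz by (auto simp: f_def strict_mono_on_def)
    moreover have "\<forall>u\<in>{..<length [a, b, c]}. \<forall>v\<in>{..<length [a, b, c]}.
        p (f u) < p (f v) \<longleftrightarrow> [a, b, c] ! u < [a, b, c] ! v"
      unfolding three by (simp add: f_def ord)
    then have "\<forall>u<length [a, b, c]. \<forall>v<length [a, b, c].
        p (f u) < p (f v) \<longleftrightarrow> [a, b, c] ! u < [a, b, c] ! v"
      by (simp only: Ball_def lessThan_iff)
    ultimately show ?L
      unfolding contains_pattern_def three by (intro exI[of _ f] conjI)
  }
qed

lemma contains_132_iff:
  "contains_pattern n p [1, 3, 2] \<longleftrightarrow>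
    (\<exists>x y z. 1 \<le> x \<and> x < y \<and> y < z \<and> z \<le> n \<and> p x < p z \<and> p z < p y)"
  unfolding contains_pattern_3_iff by (intro iff_exI) auto

lemma contains_321_iff:
  "contains_pattern n p [3, 2, 1] \<longleftrightarrow>
    (\<exists>x y z. 1 \<le> x \<and> x < y \<and> y < z \<and> z \<le> n \<and> p z < p y \<and> p y < p x)"
  unfolding contains_pattern_3_iff by (intro iff_exI) auto

text \<open>If \<open>p j < p i\<close> for excedances \<open>i < j\<close>, then the letters at the two positions \<open>i\<close> and \<open>j\<close>
  both exceed \<open>j\<close>, so the positions up to \<open>j\<close> have no room for all the letters up to \<open>j\<close>. One of
  these small letters must come after position \<open>j\<close>, and it completes a 321 pattern.\<close>

lemma excedance_values_increase:
  assumes "p \<in> avoiding_perms n [3, 2, 1]"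
    and i: "i \<in> excedances n p" and j: "j \<in> excedances n p" and "i < j"
  shows "p i < p j"
proof (rule ccontr)
  assume "\<not> p i < p j"
  have perm: "p permutes {1..n}" and avoid: "\<not> contains_pattern n p [3, 2, 1]"
    using assms(1) by (auto simp: avoiding_perms_def)
  have "p i \<noteq> p j"
    using inj_eq[OF permutes_inj[OF perm], of i j] \<open>i < j\<close> by simp
  then have desc: "p j < p i" using \<open>\<not> p i < p j\<close> by simp
  have bounds: "1 \<le> i" "j < n" "j < p j"
    using i j by (auto simp: excedances_def)
  let ?V = "inv p ` {1..j}"
  have "card ?V = card {1..j}"
    by (rule card_image[OF inj_on_subset[OF permutes_inj[OF permutes_inv[OF perm]] subset_UNIV]])
  then have "card ?V = j" by (simp only: card_atLeastAtMost diff_Suc_1)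
  moreover have "card ({1..j} - {i, j}) \<le> card {1..<j}"
    by (rule card_mono) auto
  then have "card ({1..j} - {i, j}) < j" using bounds \<open>i < j\<close> by simp
  ultimately have "\<not> ?V \<subseteq> {1..j} - {i, j}"
    using card_mono[of "{1..j} - {i, j}" ?V] by auto
  then obtain v where v: "v \<in> {1..j}" "inv p v \<notin> {1..j} - {i, j}" by blast
  have pv: "p (inv p v) = v" using permutes_inverses(1)[OF perm] .
  have "inv p v \<in> {1..n}"
    using permutes_in_image[OF permutes_inv[OF perm], of v] v bounds by auto
  moreover have "inv p v \<noteq> i" "inv p v \<noteq> j"
    using pv v(1) desc bounds by auto
  ultimately have "j < inv p v" "inv p v \<le> n" using v(2) by auto
  moreover have "p (inv p v) < p j" using pv v(1) bounds by simp
  ultimately have "contains_pattern n p [3, 2, 1]"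
    unfolding contains_321_iff using bounds(1) \<open>i < j\<close> desc by blast
  then show False using avoid by simp
qed

section \<open>Permutations and their diagrams\<close>

lemma in_diagram_iff:
  assumes "\<sigma> permutes {1..n}"
  shows "(i, j) \<in> diagram n \<sigma> \<longleftrightarrow>
    i \<in> {1..n} \<and> j \<in> {1..n} \<and> j < \<sigma> i \<and> j \<notin> \<sigma> ` {1..i}"
proof -
  have "i < inv \<sigma> j \<longleftrightarrow> j \<notin> \<sigma> ` {1..i}" if "j \<in> {1..n}"
  proof -
    have "1 \<le> inv \<sigma> j"
      using permutes_in_image[OF permutes_inv[OF assms], of j] that by simp
    moreover have "j \<in> \<sigma> ` {1..i} \<longleftrightarrow> inv \<sigma> j \<in> {1..i}"
      using permutes_inverses[OF assms] by (auto intro: image_eqI[of _ \<sigma> "inv \<sigma> j"])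
    ultimately show ?thesis by auto
  qed
  then show ?thesis by (auto simp: diagram_def)
qed

text \<open>At the first position \<open>i\<close> where \<open>p\<close> and \<open>q\<close> differ, say with \<open>p i < q i\<close>, the letter \<open>p i\<close>
  has not been used by \<open>q\<close> so far; hence the square \<open>(i, p i)\<close> lies in the diagram of \<open>q\<close>, but not in
  that of \<open>p\<close>.\<close>

lemma diagram_inject:
  assumes p: "p permutes {1..n}" and q: "q permutes {1..n}" and eq: "diagram n p = diagram n q"
  shows "p = q"
proof
  have not_less: "\<not> p i < q i"
    if p: "p permutes {1..n}" and q: "q permutes {1..n}" and eq: "diagram n p = diagram n q"
      and i: "i \<in> {1..n}" and earlier: "\<And>k. k < i \<Longrightarrow> p k = q k" for i p q
  proof
    assume less: "p i < q i"
    have "p i \<notin> p ` {1..<i}"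
      by (auto simp: inj_eq[OF permutes_inj[OF p]])
    moreover have "q ` {1..i} = insert (q i) (p ` {1..<i})"
    proof -
      have "{1..i} = insert i {1..<i}" using i by auto
      then show ?thesis using earlier by auto
    qed
    ultimately have "p i \<notin> q ` {1..i}" using less by auto
    moreover have "p i \<in> {1..n}" using permutes_in_image[OF p] i by blast
    ultimately have "(i, p i) \<in> diagram n q"
      using less i by (simp only: in_diagram_iff[OF q]) simp
    then show False
      using eq in_diagram_iff[OF p] by blast
  qed
  show "p i = q i" for i
  proof (induction i rule: less_induct)
    case (less i)
    show ?case
    proof (cases "i \<in> {1..n}")
      case True
      have "\<not> p i < q i" by (rule not_less[OF p q eq True]) (rule less)
      moreover have "\<not> q i < p i"
        by (rule not_less[OF q p eq[symmetric] True]) (rule less[symmetric])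
      ultimately show ?thesis by simp
    next
      case False
      then show ?thesis
        using p q by (simp add: permutes_not_in)
    qed
  qed
qed

section \<open>Young diagrams and their corners\<close>

text \<open>The rows run over \<open>{1..n}\<close> rather than \<open>{1..n - 1}\<close>: the bound forces the last row to be
  empty, so that comparing row \<open>i\<close> with row \<open>i + 1\<close> is meaningful for every \<open>i < n\<close>.\<close>

definition staircase_partition :: "nat \<Rightarrow> (nat \<Rightarrow> nat) \<Rightarrow> bool" where
  "staircase_partition n l \<longleftrightarrow> antimono_on {1..n} l \<and> (\<forall>i\<in>{1..n}. l i \<le> n - i)"

lemma staircase_partitionD:
  assumes "staircase_partition n l"
  shows "1 \<le> i \<Longrightarrow> i \<le> j \<Longrightarrow> j \<le> n \<Longrightarrow> l j \<le> l i" "1 \<le> i \<Longrightarrow> i \<le> n \<Longrightarrow> l i \<le> n - i"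
  using assms by (auto simp: staircase_partition_def monotone_on_def)

lemma staircase_diagram_rows:
  assumes "Y \<in> staircase_diagrams n"
  obtains l where "staircase_partition n l" "Y = young_diagram n l"
proof -
  obtain l where l: "antimono_on {1..n - 1} l" "\<forall>i\<in>{1..n - 1}. l i \<le> n - i"
    and Y: "Y = young_diagram n l"
    using assms by (auto simp: staircase_diagrams_def)
  have "staircase_partition n (l(n := 0))"
    using l by (auto simp: staircase_partition_def monotone_on_def)
  moreover have "Y = young_diagram n (l(n := 0))"
    unfolding Y young_diagram_def by (auto split: if_splits)
  ultimately show ?thesis using that by blast
qed

lemma young_diagram_in_staircase_diagrams:
  assumes "staircase_partition n l"
  shows "young_diagram n l \<in> staircase_diagrams n"
  using assms
  by (auto simp: staircase_diagrams_def staircase_partition_def monotone_on_def intro!: exI[of _ l])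

lemma in_young_diagram_iff:
  assumes "staircase_partition n l"
  shows "(i, j) \<in> young_diagram n l \<longleftrightarrow> i \<in> {1..n} \<and> 1 \<le> j \<and> j \<le> l i"
proof -
  have "i \<noteq> n" if "i \<in> {1..n}" "1 \<le> j" "j \<le> l i"
    using staircase_partitionD(2)[OF assms, of i] that by auto
  then show ?thesis by (fastforce simp: young_diagram_def)
qed

lemma corners_young_diagram:
  assumes l: "staircase_partition n l"
  shows "corners (young_diagram n l) = (\<lambda>i. (i, l i)) ` {i \<in> {1..n - 1}. l (Suc i) < l i}"
proof -
  have "(i, j) \<in> corners (young_diagram n l) \<longleftrightarrow> i \<in> {1..n - 1} \<and> l (Suc i) < l i \<and> j = l i"
    for i j
  proof (cases "i \<in> {1..n - 1}")
    case True
    then show ?thesis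
      using in_young_diagram_iff[OF l] by (auto simp: corners_def)
  next
    case False
    then show ?thesis by (auto simp: corners_def young_diagram_def)
  qed
  then show ?thesis by force
qed

text \<open>From a square of the diagram, going down its column as far as possible and then to the end
  of that row leads to a corner.\<close>

lemma young_diagram_below_corners:
  assumes l: "staircase_partition n l"
  shows "young_diagram n l =
    {(i, j). 1 \<le> i \<and> 1 \<le> j \<and> (\<exists>(i', j')\<in>corners (young_diagram n l). i \<le> i' \<and> j \<le> j')}"
    (is "?Y = ?Z")
proof (intro equalityI subrelI)
  note mem = in_young_diagram_iff[OF l]
  fix i j
  {
    assume ij: "(i, j) \<in> ?Y"
    define P where "P = (\<lambda>k. i \<le> k \<and> (k, j) \<in> ?Y)"
    define k where "k = Greatest P"
    have bound: "\<forall>k. P k \<longrightarrow> k \<le> n" using mem by (auto simp: P_def)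
    have Pi: "P i" using ij by (simp add: P_def)
    have k: "P k" unfolding k_def by (rule GreatestI_nat[of _ i n]) (use bound Pi in auto)
    have "\<not> P (Suc k)"
      using Greatest_le_nat[of P "Suc k" n] bound by (auto simp: k_def)
    then have "(Suc k, l k) \<notin> ?Y" "(k, l k) \<in> ?Y" "i \<le> k" "j \<le> l k"
      using k mem by (auto simp: P_def)
    then have "(k, l k) \<in> corners ?Y"
      using mem by (auto simp: corners_def)
    then show "(i, j) \<in> ?Z"
      using ij \<open>i \<le> k\<close> \<open>j \<le> l k\<close> mem by auto
  next
    assume "(i, j) \<in> ?Z"
    then obtain i' j' where "(i', j') \<in> ?Y" "1 \<le> i" "1 \<le> j" "i \<le> i'" "j \<le> j'"
      by (auto simp: corners_def)
    then show "(i, j) \<in> ?Y"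
      using staircase_partitionD(1)[OF l, of i i'] by (auto simp: mem)
  }
qed

lemma staircase_diagram_determined_by_corners:
  assumes "Y \<in> staircase_diagrams n" "Z \<in> staircase_diagrams n" "corners Y = corners Z"
  shows "Y = Z"
proof -
  obtain l m where "staircase_partition n l" "Y = young_diagram n l"
    and "staircase_partition n m" "Z = young_diagram n m"
    using assms(1,2) staircase_diagram_rows by metis
  then show ?thesis
    using young_diagram_below_corners[of n l] young_diagram_below_corners[of n m] assms(3) by simp
qed

text \<open>The row lengths of the Young diagram spanned by the squares \<open>(k, c k)\<close> for \<open>k \<in> E\<close>; the
  inserted 0 is the length of a row below all of them.\<close>

definition rows_from_corners :: "nat set \<Rightarrow> (nat \<Rightarrow> nat) \<Rightarrow> nat \<Rightarrow> nat" where
  "rows_from_corners E c i = Max (insert 0 (c ` {k \<in> E. i \<le> k}))"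

lemma rows_from_corners_at_next:
  assumes "finite E" and dec: "\<And>i j. i \<in> E \<Longrightarrow> j \<in> E \<Longrightarrow> i < j \<Longrightarrow> c j < c i"
    and k: "k \<in> E" "i \<le> k" "\<And>k'. k' \<in> E \<Longrightarrow> i \<le> k' \<Longrightarrow> k \<le> k'"
  shows "rows_from_corners E c i = c k"
  unfolding rows_from_corners_def
proof (rule Max_eqI)
  show "y \<le> c k" if "y \<in> insert 0 (c ` {k \<in> E. i \<le> k})" for y
    using that dec k by (auto simp: le_less)
qed (use assms in auto)

lemma rows_from_corners_after_last:
  assumes "\<And>k. k \<in> E \<Longrightarrow> k < i"
  shows "rows_from_corners E c i = 0"
proof -
  have none: "{k \<in> E. i \<le> k} = {}" using assms by fastforce
  show ?thesis unfolding rows_from_corners_def none by simp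
qed

lemma rows_from_corners:
  assumes E: "E \<subseteq> {1..n - 1}" and dec: "\<And>i j. i \<in> E \<Longrightarrow> j \<in> E \<Longrightarrow> i < j \<Longrightarrow> c j < c i"
    and bound: "\<And>i. i \<in> E \<Longrightarrow> 0 < c i \<and> c i \<le> n - i"
  shows "staircase_partition n (rows_from_corners E c)"
    and "{i \<in> {1..n - 1}. rows_from_corners E c (Suc i) < rows_from_corners E c i} = E"
    and "corners (young_diagram n (rows_from_corners E c)) = (\<lambda>i. (i, c i)) ` E"
proof -
  let ?l = "rows_from_corners E c"
  have fin: "finite E" using E finite_subset by blast
  have anti: "?l j \<le> ?l i" if "i \<le> j" for i j
    unfolding rows_from_corners_def by (rule Max_mono) (use that fin in auto)
  have le: "?l i \<le> n - i" for i
  proof -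
    have "c k \<le> n - i" if "k \<in> E" "i \<le> k" for k
      using bound[OF that(1)] that(2) by linarith
    then show ?thesis unfolding rows_from_corners_def using fin by auto
  qed
  show part: "staircase_partition n ?l"
    using anti le by (auto simp: staircase_partition_def monotone_on_def)
  have at: "?l i = c i" if "i \<in> E" for i
    by (rule rows_from_corners_at_next[OF fin dec]) (use that in auto)
  have "?l (Suc i) < ?l i" if "i \<in> E" for i
  proof -
    have "c k < c i" if "k \<in> E" "Suc i \<le> k" for k
      using dec[of i k] \<open>i \<in> E\<close> that by simp
    moreover have "?l (Suc i) \<in> insert 0 (c ` {k \<in> E. Suc i \<le> k})"
      unfolding rows_from_corners_def by (rule Max_in) (use fin in auto)
    ultimately show ?thesis
      using bound[OF that] at[OF that] by auto
  qed
  moreover have "?l (Suc i) = ?l i" if "i \<notin> E" for i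
  proof -
    have same: "{k \<in> E. Suc i \<le> k} = {k \<in> E. i \<le> k}"
      using that by (auto simp: Suc_le_eq le_less)
    show ?thesis unfolding rows_from_corners_def same ..
  qed
  ultimately show desc: "{i \<in> {1..n - 1}. ?l (Suc i) < ?l i} = E"
    using E by force
  show "corners (young_diagram n ?l) = (\<lambda>i. (i, c i)) ` E"
    unfolding corners_young_diagram[OF part] desc using at by auto
qed

section \<open>The permutation with a given Young diagram\<close>

text \<open>The letters of the 132-avoiding permutation whose diagram has row lengths \<open>l\<close>: each one is
  the least letter above the row length that has not yet been used.\<close>

function greedy :: "(nat \<Rightarrow> nat) \<Rightarrow> nat \<Rightarrow> nat" where
  "greedy l i = (LEAST j. l i < j \<and> j \<notin> greedy l ` {1..<i})"
  by auto
termination by (relation "measure snd") auto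

declare greedy.simps [simp del]

lemma greedy_properties:
  shows greedy_gt: "l i < greedy l i"
    and greedy_new: "greedy l i \<notin> greedy l ` {1..<i}"
    and greedy_le: "l i < j \<Longrightarrow> j \<notin> greedy l ` {1..<i} \<Longrightarrow> greedy l i \<le> j"
proof -
  let ?P = "\<lambda>j. l i < j \<and> j \<notin> greedy l ` {1..<i}"
  have "finite ({..l i} \<union> greedy l ` {1..<i})" by simp
  then have "\<exists>j. j \<notin> {..l i} \<union> greedy l ` {1..<i}"
    by (rule ex_new_if_finite[OF infinite_UNIV_nat])
  then have "\<exists>j. ?P j" by (simp add: not_le)
  then have "?P (Least ?P)" by (rule LeastI_ex)
  moreover have eq: "greedy l i = Least ?P" by (rule greedy.simps)
  ultimately show "l i < greedy l i" "greedy l i \<notin> greedy l ` {1..<i}" by simp_all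
  show "greedy l i \<le> j" if "l i < j" "j \<notin> greedy l ` {1..<i}"
    unfolding eq by (rule Least_le) (use that in simp)
qed

text \<open>The bound \<open>l i \<le> n - i\<close> leaves at least \<open>i\<close> letters above \<open>l i\<close>, of which fewer than \<open>i\<close>
  are used, so the greedy choice stays within \<open>{1..n}\<close>. Minimality of the choice puts no letter
  above \<open>l i\<close> into row \<open>i\<close> of the diagram. Conversely, each letter up to position \<open>i\<close> exceeds its
  own row length, which is at least \<open>l i\<close>, so the letters up to \<open>l i\<close> are all still unused.
  In a 132 pattern at \<open>x < y < z\<close> the letter at \<open>z\<close> would lie in row \<open>y\<close>, hence be at most \<open>l y \<le> l x\<close>, below the letter at \<open>x\<close>.\<close>

lemma staircase_permutation_exists:
  assumes l: "staircase_partition n l"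
  shows "\<exists>\<sigma>\<in>avoiding_perms n [1, 3, 2]. diagram n \<sigma> = young_diagram n l"
proof -
  define \<sigma> where "\<sigma> = (\<lambda>i. if i \<in> {1..n} then greedy l i else i)"
  have eq: "\<sigma> i = greedy l i" if "i \<in> {1..n}" for i
    using that by (simp add: \<sigma>_def)
  have img: "\<sigma> ` {1..i} = greedy l ` {1..i}" if "i \<le> n" for i
    using that by (intro image_cong) (auto simp: eq)
  have "inj_on \<sigma> {1..n}"
  proof (rule linorder_inj_onI)
    show "\<sigma> i \<noteq> \<sigma> j" if "i < j" "i \<in> {1..n}" "j \<in> {1..n}" for i j
    proof -
      have "greedy l i \<in> greedy l ` {1..<j}" using that by (intro imageI) simp
      then show ?thesis using greedy_new[of l j] that by (metis eq)
    qed
  qed auto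
  moreover have "greedy l i \<in> {1..n}" if i: "i \<in> {1..n}" for i
  proof -
    have "card (greedy l ` {1..<i}) \<le> i - 1"
      using card_image_le[of "{1..<i}" "greedy l"] by simp
    also have "\<dots> < card {l i<..n}"
      using staircase_partitionD(2)[OF l, of i] i by (simp, arith)
    finally have "\<not> {l i<..n} \<subseteq> greedy l ` {1..<i}"
      by (meson card_mono finite_atLeastLessThan finite_imageI leD)
    then obtain j where "j \<in> {l i<..n}" "j \<notin> greedy l ` {1..<i}" by blast
    then have "greedy l i \<le> n" using greedy_le[of l i j] by simp
    then show ?thesis using greedy_gt[of l i] by simp
  qed
  then have "\<sigma> ` {1..n} \<subseteq> {1..n}" using eq by (simp add: image_subset_iff)
  ultimately have "bij_betw \<sigma> {1..n} {1..n}"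
    by (simp only: bij_betw_def endo_inj_surj finite_atLeastAtMost simp_thms)
  then have perm: "\<sigma> permutes {1..n}"
    by (rule bij_imp_permutes) (simp only: \<sigma>_def if_False)
  have "(i, j) \<in> diagram n \<sigma> \<longleftrightarrow> (i, j) \<in> young_diagram n l" for i j
  proof (cases "i \<in> {1..n}")
    case False
    then show ?thesis by (auto simp: diagram_def young_diagram_def)
  next
    case True
    then have split: "{1..i} = insert i {1..<i}" by auto
    have "j \<le> l i" if "j < greedy l i" "j \<notin> greedy l ` {1..i}"
      using greedy_le[of l i j] that split by fastforce
    moreover have "j < greedy l i" "j \<notin> greedy l ` {1..i}" "j \<le> n" if "j \<le> l i"
    proof -
      show "j < greedy l i" using greedy_gt[of l i] that by simp
      have "j < greedy l k" if "k \<in> {1..i}" for k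
        using greedy_gt[of l k] staircase_partitionD(1)[OF l, of k i] that \<open>j \<le> l i\<close> True by auto
      then show "j \<notin> greedy l ` {1..i}" by blast
      show "j \<le> n" using staircase_partitionD(2)[OF l, of i] that True by auto
    qed
    ultimately show ?thesis
      using True by (auto simp: in_diagram_iff[OF perm] in_young_diagram_iff[OF l] eq img)
  qed
  then have diag: "diagram n \<sigma> = young_diagram n l" by auto
  have "\<not> contains_pattern n \<sigma> [1, 3, 2]"
  proof
    assume "contains_pattern n \<sigma> [1, 3, 2]"
    then obtain x y z where xyz: "1 \<le> x" "x < y" "y < z" "z \<le> n" "\<sigma> x < \<sigma> z" "\<sigma> z < \<sigma> y"
      unfolding contains_132_iff by blast
    have "(y, \<sigma> z) \<in> diagram n \<sigma>"
      using xyz permutes_in_image[OF perm, of z] permutes_inverses(2)[OF perm]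
      by (auto simp: diagram_def)
    then have "\<sigma> z \<le> l y" by (simp add: diag in_young_diagram_iff[OF l])
    also have "l y \<le> l x" using staircase_partitionD(1)[OF l, of x y] xyz by simp
    also have "l x < \<sigma> x" using xyz greedy_gt[of l x] by (simp add: eq)
    finally show False using xyz by simp
  qed
  then show ?thesis using perm diag by (auto simp: avoiding_perms_def)
qed

text \<open>Everything about \<open>\<Phi>\<close> that the comparison of the paths uses: the row lengths of its diagram
  and the fact that they drop exactly after the excedances of \<open>\<pi>\<close>.\<close>

lemma Phi_characterization:
  assumes \<pi>: "\<pi> \<in> avoiding_perms n [3, 2, 1]"
  defines "l \<equiv> rows_from_corners (excedances n \<pi>) (\<lambda>i. n + 1 - \<pi> i)"
  shows "Phi n \<pi> permutes {1..n}" and "diagram n (Phi n \<pi>) = young_diagram n l"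
    and "staircase_partition n l"
    and "{i \<in> {1..n - 1}. l (Suc i) < l i} = excedances n \<pi>"
proof -
  let ?E = "excedances n \<pi>" and ?c = "\<lambda>i. n + 1 - \<pi> i"
  have perm: "\<pi> permutes {1..n}" using \<pi> by (simp add: avoiding_perms_def)
  have E: "?E \<subseteq> {1..n - 1}" by (auto simp: excedances_def)
  have range: "i < \<pi> i" "\<pi> i \<le> n" if "i \<in> ?E" for i
    using that permutes_in_image[OF perm, of i] by (auto simp: excedances_def)
  have dec: "?c j < ?c i" if "i \<in> ?E" "j \<in> ?E" "i < j" for i j
    using excedance_values_increase[OF \<pi> that] range[of j] that by simp
  have bound: "0 < ?c i \<and> ?c i \<le> n - i" if "i \<in> ?E" for i
    using range[OF that] by auto
  note rows = rows_from_corners[of ?E n ?c, OF E dec bound, folded l_def]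
  show part: "staircase_partition n l" and "{i \<in> {1..n - 1}. l (Suc i) < l i} = ?E"
    using rows by blast+
  obtain \<sigma> where \<sigma>: "\<sigma> \<in> avoiding_perms n [1, 3, 2]" "diagram n \<sigma> = young_diagram n l"
    using staircase_permutation_exists[OF part] by blast
  have "Phi n \<pi> = \<sigma>"
    unfolding Phi_def
  proof (rule the_equality)
    have stair: "diagram n \<sigma> \<in> staircase_diagrams n"
      using young_diagram_in_staircase_diagrams[OF part] \<sigma>(2) by simp
    have corn: "corners (diagram n \<sigma>) = (\<lambda>i. (i, ?c i)) ` ?E"
      using rows(3) \<sigma>(2) by simp
    show "\<sigma> \<in> avoiding_perms n [1, 3, 2] \<and> diagram n \<sigma> \<in> staircase_diagrams n \<and>
        corners (diagram n \<sigma>) = (\<lambda>i. (i, ?c i)) ` ?E"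
      using \<sigma>(1) stair corn by blast
    fix \<tau> assume "\<tau> \<in> avoiding_perms n [1, 3, 2] \<and> diagram n \<tau> \<in> staircase_diagrams n \<and>
        corners (diagram n \<tau>) = (\<lambda>i. (i, ?c i)) ` ?E"
    then show "\<tau> = \<sigma>"
      using staircase_diagram_determined_by_corners[OF _ stair, of "diagram n \<tau>"] corn \<sigma>(1)
      by (intro diagram_inject[of _ n]) (auto simp: avoiding_perms_def)
  qed
  then show "Phi n \<pi> permutes {1..n}" "diagram n (Phi n \<pi>) = young_diagram n l"
    using \<sigma> by (simp_all add: avoiding_perms_def)
qed

section \<open>Left-to-right minima and row lengths\<close>

text \<open>The diagram forces \<open>\<sigma> i\<close> to be the least unused letter above \<open>l i\<close>. If row \<open>i + 1\<close> is
  shorter than row \<open>i\<close>, then the first \<open>i\<close> letters exceed \<open>l i\<close>, so \<open>l (i + 1) + 1\<close> is still unused: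
  it is chosen and is a new minimum. If the two rows have the same length, then \<open>\<sigma> (i + 1)\<close> was
  already a candidate for \<open>\<sigma> i\<close> and was not chosen, so it is larger than \<open>\<sigma> i\<close>.\<close>

lemma left_to_right_minima_of_young_diagram:
  assumes perm: "\<sigma> permutes {1..n}" and l: "staircase_partition n l"
    and diag: "diagram n \<sigma> = young_diagram n l" and "0 < n"
  shows "lr_min_positions n \<sigma> = insert 1 (Suc ` {i \<in> {1..n - 1}. l (Suc i) < l i})"
    and "i \<in> lr_min_positions n \<sigma> \<Longrightarrow> \<sigma> i = Suc (l i)"
proof -
  have mem: "i \<in> {1..n} \<and> j \<in> {1..n} \<and> j < \<sigma> i \<and> j \<notin> \<sigma> ` {1..i} \<longleftrightarrow>
      i \<in> {1..n} \<and> 1 \<le> j \<and> j \<le> l i" for i j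
    using in_diagram_iff[OF perm, of i j] in_young_diagram_iff[OF l, of i j] diag by blast
  have range: "\<sigma> i \<in> {1..n}" if "i \<in> {1..n}" for i
    using permutes_in_image[OF perm] that by blast
  have inj: "\<sigma> i = \<sigma> j \<longleftrightarrow> i = j" for i j
    by (rule inj_eq[OF permutes_inj[OF perm]])
  have gt: "l i < \<sigma> i" if "i \<in> {1..n}" for i
  proof (cases "l i = 0")
    case True
    then show ?thesis using range[OF that] by simp
  next
    case False
    then show ?thesis using mem[of i "l i"] that by auto
  qed
  \<comment> \<open>An unused letter between the row length and \<open>\<sigma> i\<close> would be a further square of row \<open>i\<close>.\<close>
  have le: "\<sigma> i \<le> j" if "i \<in> {1..n}" "l i < j" "j \<notin> \<sigma> ` {1..<i}" for i j
  proof (rule ccontr)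
    assume "\<not> \<sigma> i \<le> j"
    then have "j < \<sigma> i" by simp
    moreover have "{1..i} = insert i {1..<i}" using that(1) by auto
    ultimately have "j \<notin> \<sigma> ` {1..i}" using that(3) by auto
    then show False
      using mem[of i j] that(1,2) \<open>j < \<sigma> i\<close> range[OF that(1)] by auto
  qed
  have first: "\<sigma> 1 = Suc (l 1)"
    using gt[of 1] le[of 1 "Suc (l 1)"] \<open>0 < n\<close> by simp
  have drop: "\<sigma> (Suc i) = Suc (l (Suc i))" "\<forall>k\<in>{1..<Suc i}. \<sigma> (Suc i) < \<sigma> k"
    if i: "i \<in> {1..n - 1}" "l (Suc i) < l i" for i
  proof -
    have *: "Suc (l (Suc i)) < \<sigma> k" if "k \<in> {1..<Suc i}" for k
      using gt[of k] staircase_partitionD(1)[OF l, of k i] that i by fastforce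
    have "Suc (l (Suc i)) \<notin> \<sigma> ` {1..<Suc i}"
      using * by fastforce
    then have "\<sigma> (Suc i) \<le> Suc (l (Suc i))"
      using i by (intro le) auto
    moreover have "Suc i \<in> {1..n}" using i by auto
    ultimately show val: "\<sigma> (Suc i) = Suc (l (Suc i))"
      using gt[of "Suc i"] by simp
    show "\<forall>k\<in>{1..<Suc i}. \<sigma> (Suc i) < \<sigma> k" using * val by simp
  qed
  have level: "\<sigma> i < \<sigma> (Suc i)" if i: "i \<in> {1..n - 1}" "\<not> l (Suc i) < l i" for i
  proof -
    have "l i = l (Suc i)"
      using i staircase_partitionD(1)[OF l, of i "Suc i"] by fastforce
    then have "\<sigma> i \<le> \<sigma> (Suc i)"
      using i gt[of "Suc i"] by (intro le) (auto simp: inj)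
    then show ?thesis using inj[of i "Suc i"] by simp
  qed
  show set: "lr_min_positions n \<sigma> = insert 1 (Suc ` {i \<in> {1..n - 1}. l (Suc i) < l i})"
    (is "?M = ?D")
  proof (intro equalityI subsetI)
    fix i assume i: "i \<in> ?M"
    show "i \<in> ?D"
    proof (cases "i = 1")
      case False
      then obtain k where k: "i = Suc k" "k \<in> {1..n - 1}"
        using i by (cases i) (auto simp: lr_min_positions_def)
      then have "\<sigma> (Suc k) < \<sigma> k" using i by (auto simp: lr_min_positions_def)
      then show ?thesis using level[of k] k by force
    qed simp
  next
    fix i assume "i \<in> ?D"
    then show "i \<in> ?M"
      using drop \<open>0 < n\<close> by (auto simp: lr_min_positions_def)
  qed
  show "\<sigma> i = Suc (l i)" if "i \<in> lr_min_positions n \<sigma>"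
    using that first drop unfolding set by auto
qed

section \<open>Comparison of the two Dyck paths\<close>

lemma sorted_list_of_insert_one_Suc:
  assumes "finite E" "0 \<notin> E"
  shows "sorted_list_of_set (insert 1 (Suc ` E)) = 1 # map Suc (sorted_list_of_set E)"
proof (rule strict_sorted_equal)
  show "sorted_wrt (<) (1 # map Suc (sorted_list_of_set E))"
    using assms by (auto simp: sorted_wrt_map intro!: Nat.gr0I)
  show "set (sorted_list_of_set (insert 1 (Suc ` E))) = set (1 # map Suc (sorted_list_of_set E))"
    using assms by (simp only: set_sorted_list_of_set finite_insert finite_imageI list.set set_map)
qed (rule strict_sorted_list_of_set)

theorem theorem3p1:
  fixes n :: nat and \<pi> :: "nat \<Rightarrow> nat"
  assumes "\<pi> \<in> avoiding_perms n [3, 2, 1]"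
  shows "Psi_BJS n \<pi> = Psi_K n (Phi n \<pi>)"
proof (cases "n = 0")
  case True
  then show ?thesis
    by (simp add: Psi_BJS_def Psi_K_def excedances_def lr_min_positions_def)
next
  case False
  define E where "E = excedances n \<pi>"
  define "is" where "is = sorted_list_of_set E"
  define e where "e = length is"
  define l where "l = rows_from_corners E (\<lambda>i. n + 1 - \<pi> i)"
  define \<sigma> where "\<sigma> = Phi n \<pi>"
  define a where "a = (\<lambda>k. if k = 0 then 0 else if k \<le> e then \<pi> (is ! (k - 1)) - 1 else n)"
  define b where "b = (\<lambda>k. if k = 0 then 0 else if k \<le> e then is ! (k - 1) else n)"
  define ps where "ps = 1 # map Suc is"
  define c where "c = (\<lambda>k. if k = 0 then n + 1 else \<sigma> (ps ! (k - 1)))"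
  define d where "d = (\<lambda>k. 1 + card {i \<in> {1..n}. ps ! (k - 1) < i \<and> (k < e + 1 \<longrightarrow> i < ps ! k)})"

  have perm: "\<pi> permutes {1..n}" using assms by (simp add: avoiding_perms_def)
  note Phi = Phi_characterization[OF assms, folded E_def, folded l_def \<sigma>_def]
  have E: "E \<subseteq> {1..n - 1}" by (auto simp: E_def excedances_def)
  then have fin: "finite E" "0 \<notin> E" by (auto intro: finite_subset)
  have set_is: "set is = E" and sorted: "sorted_wrt (<) is"
    using fin by (simp_all add: is_def)
  have pos: "0 < i" and less_n: "i < n" if "i \<in> E" for i
    using that E False by fastforce+
  have range: "i < \<pi> i" "\<pi> i \<le> n" if "i \<in> E" for i
    using that permutes_in_image[OF perm, of i] by (auto simp: E_def excedances_def)
  have dec: "n + 1 - \<pi> j < n + 1 - \<pi> i" if "i \<in> E" "j \<in> E" "i < j" for i j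
  proof -
    have "\<pi> i < \<pi> j"
      using excedance_values_increase[OF assms] that by (simp add: E_def)
    then show ?thesis using range(2)[of j] that by linarith
  qed
  have nth_E: "is ! k \<in> E" if "k < e" for k
    using that set_is by (auto simp: e_def)

  note minima = left_to_right_minima_of_young_diagram[OF Phi(1,3,2), unfolded Phi(4)]
  have ps: "sorted_list_of_set (lr_min_positions n \<sigma>) = ps"
    using minima(1) False sorted_list_of_insert_one_Suc[OF fin] by (simp add: ps_def is_def)
  have ps_nth: "ps ! k = Suc (b k)" if "k \<le> e" for k
    using that by (cases k) (auto simp: ps_def b_def e_def)
  have len: "length ps = e + 1" by (simp add: ps_def e_def)

  \<comment> \<open>Row \<open>b k + 1\<close> comes right after the \<open>k\<close>-th corner (and is the top row for \<open>k = 0\<close>), so it is as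
    long as the row of the next corner, or empty if there is none.\<close>
  have row: "l (Suc (b k)) = (if k < e then n + 1 - \<pi> (is ! k) else 0)" if "k \<le> e" for k
  proof -
    have before: "is ! m \<le> b k" if "m < k" for m
    proof (cases "m = k - 1")
      case False
      then have "m < k - 1" using that by simp
      then have "is ! m < is ! (k - 1)"
        using sorted_wrt_nth_less[OF sorted, of m "k - 1"] \<open>k \<le> e\<close> by (simp add: e_def)
      then show ?thesis using that \<open>k \<le> e\<close> by (simp add: b_def)
    qed (use that \<open>k \<le> e\<close> in \<open>simp add: b_def\<close>)
    show ?thesis
    proof (cases "k < e")
      case True
      have "l (Suc (b k)) = n + 1 - \<pi> (is ! k)"
        unfolding l_def
      proof (rule rows_from_corners_at_next[OF fin(1) dec])
        show "is ! k \<in> E" using nth_E[OF True] .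
        show "Suc (b k) \<le> is ! k"
          using True sorted nth_E[OF True] E
          by (cases k) (auto simp: b_def e_def sorted_wrt_iff_nth_less Suc_le_eq)
        show "is ! k \<le> k'" if k': "k' \<in> E" "Suc (b k) \<le> k'" for k'
        proof -
          obtain m where m: "m < e" "k' = is ! m"
            using k'(1) set_is by (auto simp: e_def in_set_conv_nth)
          then have "k \<le> m" using before[of m] k'(2) by force
          then show ?thesis
            using m sorted by (auto simp: e_def sorted_wrt_iff_nth_less le_less)
        qed
      qed
      then show ?thesis using True by simp
    next
      case False
      have "l (Suc (b k)) = 0"
        unfolding l_def
      proof (rule rows_from_corners_after_last)
        show "k' < Suc (b k)" if "k' \<in> E" for k'
          using that set_is before False \<open>k \<le> e\<close> by (force simp: e_def in_set_conv_nth)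
      qed
      then show ?thesis using False by simp
    qed
  qed

  have a_le: "a k \<le> n" if "k \<le> e + 1" for k
    using range(2)[OF nth_E, of "k - 1"] by (cases k) (auto simp: a_def)
  \<comment> \<open>At \<open>k = 0\<close> the conventional \<open>c\<^sub>0 = n + 1\<close> matches \<open>a\<^sub>0 = 0\<close>, and at \<open>k = e + 1\<close> the last minimum
    1 matches \<open>a\<^sub>e\<^sub>+\<^sub>1 = n\<close>.\<close>
  have c_eq: "c k = n + 1 - a k" if "k \<le> e + 1" for k
  proof (cases k)
    case 0
    then show ?thesis by (simp add: c_def a_def)
  next
    case (Suc m)
    then have m: "m \<le> e" using that by simp
    have "ps ! m \<in> lr_min_positions n \<sigma>"
      using minima(1) False m set_is nth_mem[of m ps] len by (auto simp: ps_def)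
    then have "c k = Suc (l (Suc (b m)))"
      using minima(2) False ps_nth[OF m] by (simp add: c_def Suc)
    then show ?thesis
      using row[OF m] range[OF nth_E, of m] m Suc by (auto simp: a_def)
  qed
  \<comment> \<open>The positions after the \<open>k\<close>-th minimum and before the next one are those strictly above
    \<open>b (k - 1) + 1\<close> up to \<open>b k\<close>; the value \<open>b (e + 1) = n\<close> covers the letters after the last
    minimum.\<close>
  have d_eq: "d k = b k - b (k - 1)" if k: "1 \<le> k" "k \<le> e + 1" for k
  proof -
    have in_E: "b k \<in> E" if "k \<le> e"
      using nth_E[of "k - 1"] k that by (simp add: b_def)
    have bk: "b k \<le> n"
      using less_n[OF in_E] by (cases "k \<le> e") (auto simp: b_def)
    have less: "b (k - 1) < b k"
    proof (cases "k = 1")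
      case True
      have "0 < b k" using pos[OF in_E] False by (cases "k \<le> e") (auto simp: b_def)
      then show ?thesis using True by (simp add: b_def)
    next
      case k1: False
      then have prev: "b (k - 1) = is ! (k - 2)" "is ! (k - 2) \<in> E"
        using k nth_E[of "k - 2"] by (auto simp: b_def numeral_2_eq_2)
      show ?thesis
      proof (cases "k \<le> e")
        case True
        then show ?thesis
          using prev(1) k k1 sorted_wrt_nth_less[OF sorted, of "k - 2" "k - 1"]
          by (simp add: b_def e_def)
      next
        case False
        then show ?thesis using prev less_n k by (simp add: b_def)
      qed
    qed
    have "{i \<in> {1..n}. ps ! (k - 1) < i \<and> (k < e + 1 \<longrightarrow> i < ps ! k)} = {Suc (b (k - 1))<..b k}"
      using k bk ps_nth[of k] ps_nth[of "k - 1"] by (auto simp: b_def)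
    then show ?thesis using less by (simp add: d_def)
  qed

  have "Psi_BJS n \<pi> =
      concat (map (\<lambda>k. replicate (a k - a (k - 1)) Up @ replicate (b k - b (k - 1)) Down) [1..<e + 2])"
    unfolding Psi_BJS_def Let_def a_def b_def e_def is_def E_def ..
  also have "\<dots> = concat (map (\<lambda>k. replicate (c (k - 1) - c k) Up @ replicate (d k) Down) [1..<e + 2])"
  proof (intro arg_cong[of _ _ concat] map_cong refl)
    fix k assume "k \<in> set [1..<e + 2]"
    then have k: "1 \<le> k" "k \<le> e + 1" by auto
    have "c (k - 1) - c k = a k - a (k - 1)"
      using c_eq[of k] c_eq[of "k - 1"] a_le[of k] a_le[of "k - 1"] k by simp
    then show "replicate (a k - a (k - 1)) Up @ replicate (b k - b (k - 1)) Down =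
        replicate (c (k - 1) - c k) Up @ replicate (d k) Down"
      using d_eq[OF k] by simp
  qed
  also have "\<dots> = Psi_K n \<sigma>"
    unfolding Psi_K_def Let_def ps len c_def d_def by simp
  finally show ?thesis by (simp add: \<sigma>_def)
qed

end
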